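(* Let $(\bar f,\bar g,\bar h)\in\mathcal{C}_\diamond(\mathcal{U})\times\mathcal{C}_\diamond(\mathcal{U};\mathbb{R}^{d_x})\times\mathcal{C}(\mathcal{X}\times\mathcal{Y})$ be the dual potentials. Then $$\|\bar f\|_\infty\le\|c\|_\infty,\qquad \|\bar g\|_\infty\le2\|\Sigma_X^{-1}\|_{\mathrm{op}}M_x\left(\frac52\|c\|_\infty+\varepsilon\log\left(\frac32\right)\right),\qquad \|\bar h\|_\infty\le\|c\|_\infty+\|\bar g\|_\infty M_x .$$
   Context: Setting. Let $(X,Y)$ be a random vector in $\mathbb{R}^{d_x}\times\mathbb{R}^{d_y}$ with law $\nu$; let $\mathcal{X}$, $\mathcal{Y}$ be the supports of $X$, $Y$. Let $\mu$ be a Borel probability measure on $\mathbb{R}^{d_y}$ with support $\mathcal{U}$. Assume $\mathcal{U},\mathcal{X},\mathcal{Y}$ are compact, $\mathbb{E}[X]=0$ and $\Sigma_X:=\mathbb{E}[XX^\top]$ is invertible. Fix $\varepsilon>0$; $c(u,y):=\|u-y\|^2/2$; $M_x:=\sup_{x\in\mathcal{X}}\|x\|$; $\|c\|_\infty:=\sup_{\mathcal{U}\times\mathcal{Y}}c$. The dual objective is $$D(f,g,h):=\int f\,d\mu+\int h\,d\nu-\varepsilon\left(\int e^{(f(u)+\langle g(u),x\rangle+h(x,y)-c(u,y))/\varepsilon}\,d(\mu\otimes\nu)(u,x,y)-1\right).$$ Spaces. $\mathcal{C}_\diamond(\mathcal{U})$ (resp. $\mathcal{C}_\diamond(\mathcal{U};\mathbb{R}^{d_x})$)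 is the set of continuous $f:\mathcal{U}\to\mathbb{R}$ (resp. $g:\mathcal{U}\to\mathbb{R}^{d_x}$) with $\int f\,d\mu=0$ (resp. $\int g\,d\mu=0$). $\|\cdot\|_\infty$ is the sup norm over the domain ($\mathcal{U}$ or $\mathcal{X}\times\mathcal{Y}$), using the Euclidean norm for vector values. Dual potentials. These are maximizers of $D$ over $L^1(\mu)\times L^1(\mu;\mathbb{R}^{d_x})\times L^1(\nu)$. It is known that there is a unique triple $(\bar f,\bar g,\bar h)\in\mathcal{C}_\diamond(\mathcal{U})\times\mathcal{C}_\diamond(\mathcal{U};\mathbb{R}^{d_x})\times\mathcal{C}(\mathcal{X}\times\mathcal{Y})$ of dual potentials satisfying, for all $u\in\mathcal{U}$ and all $(x,y)\in\mathcal{X}\times\mathcal{Y}$: $\bar f(u)=-\varepsilon\log\int e^{(\langle\bar g(u),x\rangle+\bar h(x,y)-c(u,y))/\varepsilon}d\nu(x,y)$; $\int x\,e^{(\langle\bar g(u),x\rangle+\bar h(x,y)-c(u,y))/\varepsilon}d\nu(x,y)=0$; $\bar h(x,y)=-\varepsilon\log\int e^{(\bar f(u)+\langle\bar g(u),x\rangle-c(u,y))/\varepsilon}d\mu(u)$. "The dual potentials" means this triple. It is also known (strong duality) that $D(\bar f,\bar g,\bar h)$ equals the minimum of $\int c\,d\pi+\varepsilon\,\mathrm{KL}(\pi\|\mu\otimes\nu)$ over couplings $\pi$ of $(\mu,\nu)$ under which the conditional mean of the $x$-coordinate given $u$ vanishes for $\mu$-a.e. $u$. *)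

theory Defs
  imports "HOL-Probability.Probability"
begin

definition measure_support :: "'a::topological_space measure \<Rightarrow> 'a set" where
  "measure_support M = {x. \<forall>S. open S \<and> x \<in> S \<longrightarrow> emeasure M S > 0}"

text \<open>
  A random vector \<open>(X, Y)\<close> is represented by its law \<open>\<nu>\<close>, a Borel probability measure on
  \<open>real^'m \<times> real^'n\<close>, with \<open>X\<close> and \<open>Y\<close> the two coordinate projections.
\<close>

definition supp_X :: "('a::topological_space \<times> 'b::topological_space) measure \<Rightarrow> 'a set" where
  "supp_X \<nu> = measure_support (distr \<nu> borel fst)"

definition supp_Y :: "('a::topological_space \<times> 'b::topological_space) measure \<Rightarrow> 'b set" where
  "supp_Y \<nu> = measure_support (distr \<nu> borel snd)"

definition second_moment_X :: "((real^'m) \<times> 'b) measure \<Rightarrow> real^'m^'m" where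
  "second_moment_X \<nu> = (\<chi> i j. LINT z|\<nu>. fst z $ i * fst z $ j)"

definition op_norm :: "real^'m^'k \<Rightarrow> real" where
  "op_norm A = onorm ((*v) A)"

definition cost :: "'a::real_normed_vector \<Rightarrow> 'a \<Rightarrow> real" where
  "cost u y = (norm (u - y))\<^sup>2 / 2"

definition sup_norm :: "'a set \<Rightarrow> ('a \<Rightarrow> 'b::real_normed_vector) \<Rightarrow> real" where
  "sup_norm S f = (SUP x\<in>S. norm (f x))"

definition cost_sup :: "(real^'n) measure \<Rightarrow> ((real^'m) \<times> (real^'n)) measure \<Rightarrow> real" where
  "cost_sup \<mu> \<nu> = (SUP (u, y)\<in>measure_support \<mu> \<times> supp_Y \<nu>. cost u y)"

text \<open>
  Functions on \<open>\<U> = measure_support \<mu>\<close> or on \<open>\<X> \<times> \<Y> = supp_X \<nu> \<times> supp_Y \<nu>\<close> are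
  represented by total functions whose values outside these sets are irrelevant. Accordingly
  all integrals involving them are taken over these sets of full measure: a total function that
  is merely continuous on \<open>\<U>\<close> need not be measurable on the whole space.
\<close>

definition expo ::
  "real \<Rightarrow> (real^'n \<Rightarrow> real) \<Rightarrow> (real^'n \<Rightarrow> real^'m) \<Rightarrow> ((real^'m) \<times> (real^'n) \<Rightarrow> real)
    \<Rightarrow> real^'n \<Rightarrow> (real^'m) \<times> (real^'n) \<Rightarrow> real" where
  "expo \<epsilon> f g h u z = exp ((f u + g u \<bullet> fst z + h z - cost u (snd z)) / \<epsilon>)"

text \<open>
  The dual objective takes values in \<open>[-\<infinity>, \<infinity>)\<close> on \<open>L\<^sup>1\<close> arguments: the exponential need not be
  integrable, in which case the value is \<open>-\<infinity>\<close>. Hence the nonnegative integral and \<open>ereal\<close>.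
\<close>

definition dual_objective ::
  "(real^'n) measure \<Rightarrow> ((real^'m) \<times> (real^'n)) measure \<Rightarrow> real
    \<Rightarrow> (real^'n \<Rightarrow> real) \<Rightarrow> (real^'n \<Rightarrow> real^'m) \<Rightarrow> ((real^'m) \<times> (real^'n) \<Rightarrow> real) \<Rightarrow> ereal" where
  "dual_objective \<mu> \<nu> \<epsilon> f g h =
     ereal ((LINT u:measure_support \<mu>|\<mu>. f u) + (LINT z:supp_X \<nu> \<times> supp_Y \<nu>|\<nu>. h z))
     - ereal \<epsilon> *
       (enn2ereal (\<integral>\<^sup>+ (u, z) \<in> measure_support \<mu> \<times> (supp_X \<nu> \<times> supp_Y \<nu>).
            ennreal (expo \<epsilon> f g h u z) \<partial>(\<mu> \<Otimes>\<^sub>M \<nu>)) - 1)"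

definition L1_triple ::
  "(real^'n) measure \<Rightarrow> ((real^'m) \<times> (real^'n)) measure
    \<Rightarrow> (real^'n \<Rightarrow> real) \<Rightarrow> (real^'n \<Rightarrow> real^'m) \<Rightarrow> ((real^'m) \<times> (real^'n) \<Rightarrow> real) \<Rightarrow> bool" where
  "L1_triple \<mu> \<nu> f g h \<longleftrightarrow>
     set_integrable \<mu> (measure_support \<mu>) f \<and>
     set_integrable \<mu> (measure_support \<mu>) g \<and>
     set_integrable \<nu> (supp_X \<nu> \<times> supp_Y \<nu>) h"

definition maximizes_dual ::
  "(real^'n) measure \<Rightarrow> ((real^'m) \<times> (real^'n)) measure \<Rightarrow> real
    \<Rightarrow> (real^'n \<Rightarrow> real) \<Rightarrow> (real^'n \<Rightarrow> real^'m) \<Rightarrow> ((real^'m) \<times> (real^'n) \<Rightarrow> real) \<Rightarrow> bool" where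
  "maximizes_dual \<mu> \<nu> \<epsilon> f g h \<longleftrightarrow>
     L1_triple \<mu> \<nu> f g h \<and>
     (\<forall>f' g' h'. L1_triple \<mu> \<nu> f' g' h' \<longrightarrow>
        dual_objective \<mu> \<nu> \<epsilon> f' g' h' \<le> dual_objective \<mu> \<nu> \<epsilon> f g h)"

definition C_diamond ::
  "'a::topological_space measure \<Rightarrow> ('a \<Rightarrow> 'b::{banach, second_countable_topology}) set" where
  "C_diamond \<mu> = {f. continuous_on (measure_support \<mu>) f \<and> (LINT u:measure_support \<mu>|\<mu>. f u) = 0}"

definition dual_potentials ::
  "(real^'n) measure \<Rightarrow> ((real^'m) \<times> (real^'n)) measure \<Rightarrow> real
    \<Rightarrow> (real^'n \<Rightarrow> real) \<Rightarrow> (real^'n \<Rightarrow> real^'m) \<Rightarrow> ((real^'m) \<times> (real^'n) \<Rightarrow> real) \<Rightarrow> bool" where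
  "dual_potentials \<mu> \<nu> \<epsilon> f g h \<longleftrightarrow>
     f \<in> C_diamond \<mu> \<and> g \<in> C_diamond \<mu> \<and> continuous_on (supp_X \<nu> \<times> supp_Y \<nu>) h \<and>
     maximizes_dual \<mu> \<nu> \<epsilon> f g h \<and>
     (\<forall>u\<in>measure_support \<mu>.
        f u = - \<epsilon> * ln (LINT z:supp_X \<nu> \<times> supp_Y \<nu>|\<nu>.
                 exp ((g u \<bullet> fst z + h z - cost u (snd z)) / \<epsilon>))) \<and>
     (\<forall>u\<in>measure_support \<mu>.
        (LINT z:supp_X \<nu> \<times> supp_Y \<nu>|\<nu>.
           exp ((g u \<bullet> fst z + h z - cost u (snd z)) / \<epsilon>) *\<^sub>R fst z) = 0) \<and>
     (\<forall>x\<in>supp_X \<nu>. \<forall>y\<in>supp_Y \<nu>.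
        h (x, y) = - \<epsilon> * ln (LINT u:measure_support \<mu>|\<mu>.
                 exp ((f u + g u \<bullet> x - cost u y) / \<epsilon>)))"

end

theory Submission
  imports Defs
begin

text \<open>
  Since \<open>f\<close> and \<open>g\<close> have mean zero, Jensen's inequality in the equation of \<open>h\<close> gives \<open>h \<le> \<parallel>c\<parallel>\<close>.
  Comparing with the zero potentials gives \<open>\<integral>h d\<nu> \<ge> 0\<close>, so Jensen's inequality in the equation of
  \<open>f\<close> gives \<open>f \<le> \<parallel>c\<parallel>\<close>. The constraint says that \<open>g u\<close> minimises the convex function
  \<open>\<theta> \<mapsto> \<integral>exp ((\<theta> \<bullet> x + h - c) / \<epsilon>) d\<nu>\<close>; comparing with \<open>\<theta> = 0\<close> gives \<open>f \<ge> -\<parallel>c\<parallel>\<close>. The lower bound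
  on \<open>h\<close> is then immediate. For \<open>g u\<close>, Jensen's inequality is applied in the equation of \<open>f\<close> with
  respect to the tilted law \<open>(1 + a \<bullet> x) d\<nu>\<close>, where \<open>a\<close> is a multiple of \<open>\<Sigma>\<^sup>-\<^sup>1 (g u)\<close> so small that
  the density lies in \<open>[1/2, 3/2]\<close>: the mean of \<open>x\<close> under this law is \<open>\<Sigma> a\<close>, a multiple of \<open>g u\<close>.
\<close>

section \<open>Supports and integrals over sets of full measure\<close>

lemma closed_measure_support: "closed (measure_support M)"
proof -
  have "open (- measure_support M)"
  proof (subst open_subopen, intro ballI)
    fix x assume "x \<in> - measure_support M"
    then obtain S where "open S" "x \<in> S" "\<not> emeasure M S > 0"
      unfolding measure_support_def by blast
    then show "\<exists>T. open T \<and> x \<in> T \<and> T \<subseteq> - measure_support M"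
      unfolding measure_support_def by blast
  qed
  then show ?thesis
    by (simp add: closed_def)
qed

text \<open>Every point off the support lies in a null basic open set, and a countable basis has
  only countably many of these.\<close>

lemma AE_measure_support:
  fixes M :: "'a::second_countable_topology measure"
  assumes "sets M = sets borel"
  shows "AE x in M. x \<in> measure_support M"
proof -
  obtain B :: "'a set set" where B: "countable B" "topological_basis B"
    using ex_countable_basis by blast
  define N where "N = {S\<in>B. emeasure M S = 0}"
  have "S \<in> null_sets M" if "S \<in> N" for S
    using that assms B(2) by (auto simp: N_def null_sets_def dest: topological_basis_open)
  moreover have "countable N"
    using B(1) by (simp add: N_def)
  ultimately have "\<Union>N \<in> null_sets M"
    using null_sets_UN'[of N "\<lambda>S. S" M] by simp
  moreover have "x \<in> \<Union>N" if x: "x \<notin> measure_support M" for x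
  proof -
    obtain S where S: "open S" "x \<in> S" "emeasure M S = 0"
      using x unfolding measure_support_def by auto
    obtain T where T: "T \<in> B" "x \<in> T" "T \<subseteq> S"
      using topological_basisE[OF B(2) S(1,2)] by blast
    have "emeasure M T \<le> emeasure M S"
      using T(3) S(1) assms by (intro emeasure_mono) auto
    then show ?thesis
      using T(1,2) S(3) by (auto simp: N_def)
  qed
  ultimately show ?thesis
    by (intro AE_I'[of "\<Union>N"]) auto
qed

lemma measure_support_nonempty:
  fixes M :: "'a::second_countable_topology measure"
  assumes "prob_space M" "sets M = sets borel"
  shows "measure_support M \<noteq> {}"
proof
  assume "measure_support M = {}"
  with AE_measure_support[OF assms(2)] have "AE x in M. False"
    by simp
  then show False
    using prob_space.AE_False[OF assms(1)] by simp
qed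

text \<open>Each marginal is concentrated on its own support, and the two almost sure events meet in
  the product. The support of the joint law may be smaller than this product.\<close>

lemma AE_supp_X_times_supp_Y:
  fixes M :: "('a::second_countable_topology \<times> 'b::second_countable_topology) measure"
  assumes "sets M = sets borel"
  shows "AE z in M. z \<in> supp_X M \<times> supp_Y M"
proof -
  have *: "fst \<in> measurable M borel" "snd \<in> measurable M borel"
    using assms by (auto simp: measurable_cong_sets[OF assms refl] intro!: borel_measurable_continuous_onI continuous_intros)
  have "AE z in M. fst z \<in> supp_X M"
    unfolding supp_X_def
    by (rule AE_distrD[OF *(1) AE_measure_support]) simp
  moreover have "AE z in M. snd z \<in> supp_Y M"
    unfolding supp_Y_def
    by (rule AE_distrD[OF *(2) AE_measure_support]) simp
  ultimately show ?thesis
    by eventually_elim (auto simp: mem_Times_iff)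
qed

lemma set_lebesgue_integral_eq_AE:
  fixes F :: "'a \<Rightarrow> 'b::{banach, second_countable_topology}"
  assumes "AE x in M. x \<in> S" "S \<in> sets M" "F \<in> borel_measurable M"
  shows "(LINT x:S|M. F x) = (LINT x|M. F x)"
  unfolding set_lebesgue_integral_def
  using assms by (intro integral_cong_AE) (auto elim!: eventually_mono)

lemma set_integral_const_AE:
  fixes c :: real
  assumes "prob_space M" "AE x in M. x \<in> S" "S \<in> sets M"
  shows "(LINT x:S|M. c) = c"
proof -
  interpret prob_space M by fact
  show ?thesis
    using set_lebesgue_integral_eq_AE[OF assms(2,3), of "\<lambda>_. c"] by (simp add: prob_space)
qed

text \<open>Continuity on \<open>S\<close> alone gives measurability only after multiplication by
  the indicator of \<open>S\<close>; compactness makes this product bounded.\<close>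

lemma set_integrable_continuous_on_compact:
  fixes F :: "'a::t2_space \<Rightarrow> 'b::{banach, second_countable_topology}"
  assumes "finite_measure M" "sets M = sets borel" "compact S" "continuous_on S F"
  shows "set_integrable M S F"
proof -
  interpret finite_measure M by fact
  have "bounded (F ` S)"
    using assms(3,4) compact_continuous_image compact_imp_bounded by blast
  then obtain B where B: "\<And>x. x \<in> S \<Longrightarrow> norm (F x) \<le> B" "B > 0"
    unfolding bounded_pos by auto
  have "(\<lambda>x. indicator S x *\<^sub>R F x) \<in> borel_measurable M"
    unfolding measurable_cong_sets[OF assms(2) refl]
    using assms(3,4) by (intro borel_measurable_continuous_on_indicator) (auto intro: borel_compact)
  then show ?thesis
    unfolding set_integrable_def
    by (rule integrable_const_bound[rotated, of _ B])
      (use B in \<open>auto simp: indicator_def less_imp_le\<close>)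
qed

lemma set_integral_inner_right:
  fixes F :: "'a \<Rightarrow> 'b::euclidean_space"
  assumes "set_integrable M S F"
  shows "(LINT x:S|M. c \<bullet> F x) = c \<bullet> (LINT x:S|M. F x)"
  using integral_inner_right[of c M "\<lambda>x. indicator S x *\<^sub>R F x"] assms
  by (simp add: set_lebesgue_integral_def set_integrable_def)

section \<open>Jensen's inequality for the exponential under a density\<close>

text \<open>The tangent of \<open>exp\<close> at the weighted mean \<open>m\<close> lies below
  \<open>exp\<close>, and its \<open>w\<close>-integral is \<open>exp m\<close>. Weight one gives
  the usual Jensen inequality; the bound on \<open>g\<close> uses an affine weight.\<close>

lemma exp_weighted_integral_le:
  fixes w \<psi> :: "'a \<Rightarrow> real"
  assumes "set_integrable M S w" "set_integrable M S (\<lambda>x. w x * \<psi> x)"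
    and "set_integrable M S (\<lambda>x. w x * exp (\<psi> x))"
    and "\<And>x. x \<in> S \<Longrightarrow> 0 \<le> w x" "(LINT x:S|M. w x) = 1"
  shows "exp (LINT x:S|M. w x * \<psi> x) \<le> (LINT x:S|M. w x * exp (\<psi> x))"
proof -
  define m where "m = (LINT x:S|M. w x * \<psi> x)"
  have "(LINT x:S|M. exp m * ((1 - m) * w x + w x * \<psi> x)) = exp m * ((1 - m) * 1 + m)"
    using assms(1,2,5) by (simp add: m_def)
  then have "exp m = (LINT x:S|M. exp m * ((1 - m) * w x + w x * \<psi> x))"
    by simp
  also have "\<dots> \<le> (LINT x:S|M. w x * exp (\<psi> x))"
  proof (rule set_integral_mono[OF _ assms(3)])
    show "set_integrable M S (\<lambda>x. exp m * ((1 - m) * w x + w x * \<psi> x))"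
      using assms(1,2) by (intro set_integrable_mult_right set_integral_add) auto
    fix x assume "x \<in> S"
    have "exp m * (1 + (\<psi> x - m)) \<le> exp m * exp (\<psi> x - m)"
      by (intro mult_left_mono exp_ge_add_one_self) auto
    also have "\<dots> = exp (\<psi> x)"
      by (simp flip: exp_add)
    finally have "w x * (exp m * (1 + (\<psi> x - m))) \<le> w x * exp (\<psi> x)"
      using assms(4)[OF \<open>x \<in> S\<close>] by (rule mult_left_mono)
    then show "exp m * ((1 - m) * w x + w x * \<psi> x) \<le> w x * exp (\<psi> x)"
      by (simp add: algebra_simps)
  qed
  finally show ?thesis
    by (simp add: m_def)
qed

section \<open>Cost, sup norms and the matrix inverse\<close>

lemma cost_nonneg: "0 \<le> cost u y"
  by (simp add: cost_def)

lemma continuous_on_cost [continuous_intros]: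
  assumes "continuous_on S p" "continuous_on S q"
  shows "continuous_on S (\<lambda>x. cost (p x) (q x))"
  unfolding cost_def by (intro continuous_intros assms) auto

lemma norm_le_sup_norm:
  assumes "compact S" "continuous_on S F" "x \<in> S"
  shows "norm (F x) \<le> sup_norm S F"
  unfolding sup_norm_def
proof (rule cSUP_upper[OF assms(3)])
  show "bdd_above ((\<lambda>x. norm (F x)) ` S)"
    using assms(1,2)
    by (intro bounded_imp_bdd_above compact_imp_bounded compact_continuous_image continuous_intros)
qed

lemma sup_norm_le:
  assumes "S \<noteq> {}" "\<And>x. x \<in> S \<Longrightarrow> norm (F x) \<le> B"
  shows "sup_norm S F \<le> B"
  unfolding sup_norm_def using assms by (rule cSUP_least)

lemma matrix_inv_right:
  fixes A :: "'a::semiring_1^'n^'m"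
  shows "invertible A \<Longrightarrow> A ** matrix_inv A = mat 1"
  unfolding invertible_def matrix_inv_def by (rule someI2_ex) auto

section \<open>Bounds on the dual potentials\<close>

locale entropic_dual =
  fixes \<mu> :: "(real^'n) measure"
    and \<nu> :: "((real^'m) \<times> (real^'n)) measure"
    and \<epsilon> :: real
    and f :: "real^'n \<Rightarrow> real"
    and g :: "real^'n \<Rightarrow> real^'m"
    and h :: "(real^'m) \<times> (real^'n) \<Rightarrow> real"
  assumes prob_\<mu>: "prob_space \<mu>" and sets_\<mu>: "sets \<mu> = sets borel"
    and prob_\<nu>: "prob_space \<nu>" and sets_\<nu>: "sets \<nu> = sets borel"
    and compact_U: "compact (measure_support \<mu>)"
    and compact_X: "compact (supp_X \<nu>)" and compact_Y: "compact (supp_Y \<nu>)"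
    and mean_X: "(LINT z|\<nu>. fst z) = 0"
    and inv_second_moment: "invertible (second_moment_X \<nu>)"
    and eps_pos: "\<epsilon> > 0"
    and dual: "dual_potentials \<mu> \<nu> \<epsilon> f g h"
begin

section \<open>The potential equations and integration over the supports\<close>

abbreviation U where "U \<equiv> measure_support \<mu>"
abbreviation Z where "Z \<equiv> supp_X \<nu> \<times> supp_Y \<nu>"
abbreviation C where "C \<equiv> cost_sup \<mu> \<nu>"

text \<open>For \<open>\<theta> = g u\<close>, multiplying by \<open>exp (f u / \<epsilon>)\<close>
  gives a probability density in \<open>z\<close>; this is the equation of \<open>f\<close>.\<close>

definition kernel :: "real^'m \<Rightarrow> real^'n \<Rightarrow> (real^'m) \<times> (real^'n) \<Rightarrow> real" where
  "kernel \<theta> u z = exp ((\<theta> \<bullet> fst z + h z - cost u (snd z)) / \<epsilon>)"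

lemma cont_f: "continuous_on U f" and cont_g: "continuous_on U g"
  and cont_h: "continuous_on Z h"
  and mean_f: "(LINT u:U|\<mu>. f u) = 0" and mean_g: "(LINT u:U|\<mu>. g u) = 0"
  and maximal: "maximizes_dual \<mu> \<nu> \<epsilon> f g h"
  using dual by (auto simp: dual_potentials_def C_diamond_def)

lemma f_eq: "u \<in> U \<Longrightarrow> f u = - \<epsilon> * ln (LINT z:Z|\<nu>. kernel (g u) u z)"
  using dual by (auto simp: dual_potentials_def kernel_def)

lemma constraint: "u \<in> U \<Longrightarrow> (LINT z:Z|\<nu>. kernel (g u) u z *\<^sub>R fst z) = 0"
  using dual by (auto simp: dual_potentials_def kernel_def)

lemma h_eq:
  "(x, y) \<in> Z \<Longrightarrow> h (x, y) = - \<epsilon> * ln (LINT u:U|\<mu>. exp ((f u + g u \<bullet> x - cost u y) / \<epsilon>))"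
  using dual by (auto simp: dual_potentials_def)

lemma compact_Z: "compact Z"
  using compact_X compact_Y by (rule compact_Times)

lemma U_sets: "U \<in> sets \<mu>" and Z_sets: "Z \<in> sets \<nu>"
  using sets_\<mu> sets_\<nu> compact_U compact_Z by (auto intro: borel_compact)

lemma AE_U: "AE u in \<mu>. u \<in> U" and AE_Z: "AE z in \<nu>. z \<in> Z"
  using AE_measure_support[OF sets_\<mu>] AE_supp_X_times_supp_Y[OF sets_\<nu>] by auto

lemma U_nonempty: "U \<noteq> {}" and Z_nonempty: "Z \<noteq> {}"
proof -
  show "U \<noteq> {}"
    using measure_support_nonempty[OF prob_\<mu> sets_\<mu>] .
  show "Z \<noteq> {}"
  proof
    assume "Z = {}"
    with AE_Z have "AE z in \<nu>. False"
      by simp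
    then show False
      using prob_space.AE_False[OF prob_\<nu>] by simp
  qed
qed

lemma integrable_U:
  fixes F :: "real^'n \<Rightarrow> 'b::{banach, second_countable_topology}"
  shows "continuous_on U F \<Longrightarrow> set_integrable \<mu> U F"
  using set_integrable_continuous_on_compact[OF prob_space.finite_measure[OF prob_\<mu>] sets_\<mu> compact_U] .

lemma integrable_Z:
  fixes F :: "(real^'m) \<times> (real^'n) \<Rightarrow> 'b::{banach, second_countable_topology}"
  shows "continuous_on Z F \<Longrightarrow> set_integrable \<nu> Z F"
  using set_integrable_continuous_on_compact[OF prob_space.finite_measure[OF prob_\<nu>] sets_\<nu> compact_Z] .

lemma const_U: "(LINT u:U|\<mu>. (c::real)) = c" and const_Z: "(LINT z:Z|\<nu>. (c::real)) = c"
  using set_integral_const_AE[OF prob_\<mu> AE_U U_sets] set_integral_const_AE[OF prob_\<nu> AE_Z Z_sets]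
  by auto

lemma mean_X_Z: "(LINT z:Z|\<nu>. fst z) = 0"
proof -
  have "(fst :: (real^'m) \<times> (real^'n) \<Rightarrow> _) \<in> borel_measurable \<nu>"
    unfolding measurable_cong_sets[OF sets_\<nu> refl]
    by (intro borel_measurable_continuous_onI continuous_intros)
  from set_lebesgue_integral_eq_AE[OF AE_Z Z_sets this] show ?thesis
    using mean_X by simp
qed

text \<open>A real \<open>SUP\<close> dominates its members only over a bounded set; compactness of
  both supports ensures this.\<close>

lemma cost_le: "u \<in> U \<Longrightarrow> y \<in> supp_Y \<nu> \<Longrightarrow> cost u y \<le> C"
proof -
  assume *: "u \<in> U" "y \<in> supp_Y \<nu>"
  have "continuous_on (U \<times> supp_Y \<nu>) (\<lambda>p. cost (fst p) (snd p))"
    by (intro continuous_intros)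
  then have "norm (cost (fst (u, y)) (snd (u, y))) \<le> sup_norm (U \<times> supp_Y \<nu>) (\<lambda>p. cost (fst p) (snd p))"
    using * compact_U compact_Y by (intro norm_le_sup_norm compact_Times) auto
  then show "cost u y \<le> C"
    by (simp add: sup_norm_def cost_sup_def case_prod_beta cost_nonneg)
qed

lemma cont_kernel [continuous_intros]: "continuous_on Z (kernel \<theta> u)"
  unfolding kernel_def using eps_pos by (intro continuous_intros cont_h) auto

lemma jensen_U:
  fixes \<psi> :: "real^'n \<Rightarrow> real"
  assumes "continuous_on U \<psi>"
  shows "exp (LINT u:U|\<mu>. \<psi> u) \<le> (LINT u:U|\<mu>. exp (\<psi> u))"
  using exp_weighted_integral_le[of \<mu> U "\<lambda>_. 1" \<psi>] assms
  by (simp add: integrable_U continuous_on_exp const_U)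

lemma jensen_Z:
  fixes \<psi> :: "(real^'m) \<times> (real^'n) \<Rightarrow> real"
  assumes "continuous_on Z \<psi>"
  shows "exp (LINT z:Z|\<nu>. \<psi> z) \<le> (LINT z:Z|\<nu>. exp (\<psi> z))"
  using exp_weighted_integral_le[of \<nu> Z "\<lambda>_. 1" \<psi>] assms
  by (simp add: integrable_Z continuous_on_exp const_Z)

text \<open>Jensen's inequality bounds the integral below by an exponential. Positivity is what
  allows \<open>ln\<close> to be undone in the equation of \<open>f\<close>.\<close>

lemma integral_kernel_pos: "0 < (LINT z:Z|\<nu>. kernel \<theta> u z)"
proof -
  have "continuous_on Z (\<lambda>z. (\<theta> \<bullet> fst z + h z - cost u (snd z)) / \<epsilon>)"
    using eps_pos by (intro continuous_intros cont_h) auto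
  from jensen_Z[OF this] show ?thesis
    unfolding kernel_def by (rule less_le_trans[OF exp_gt_zero])
qed

lemma integral_kernel: "u \<in> U \<Longrightarrow> (LINT z:Z|\<nu>. kernel (g u) u z) = exp (- f u / \<epsilon>)"
  using eps_pos integral_kernel_pos[of "g u" u] f_eq[of u] by simp

section \<open>Upper bound on \<open>h\<close>\<close>

text \<open>As \<open>f\<close> and \<open>g\<close> have mean zero, the exponent in the equation of
  \<open>h\<close> has mean at least \<open>- C / \<epsilon>\<close>; Jensen's inequality transfers
  this to the logarithm.\<close>

lemma h_upper:
  assumes "(x, y) \<in> Z"
  shows "h (x, y) \<le> C"
proof -
  define I where "I = (LINT u:U|\<mu>. exp ((f u + g u \<bullet> x - cost u y) / \<epsilon>))"
  have int: "set_integrable \<mu> U f" "set_integrable \<mu> U (\<lambda>u. x \<bullet> g u)" "set_integrable \<mu> U (\<lambda>u. C)"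
    by (intro integrable_U continuous_intros cont_f cont_g)+
  have 1: "continuous_on U (\<lambda>u. (f u + g u \<bullet> x - cost u y) / \<epsilon>)"
    using eps_pos by (intro continuous_intros cont_f cont_g) auto
  have "- C / \<epsilon> = ((LINT u:U|\<mu>. f u) + x \<bullet> (LINT u:U|\<mu>. g u) - C) / \<epsilon>"
    by (simp add: mean_f mean_g)
  also have "\<dots> = (LINT u:U|\<mu>. (f u + x \<bullet> g u - C) / \<epsilon>)"
    using int by (simp add: set_integral_inner_right const_U integrable_U cont_g)
  also have "\<dots> \<le> (LINT u:U|\<mu>. (f u + g u \<bullet> x - cost u y) / \<epsilon>)"
  proof (rule set_integral_mono)
    show "set_integrable \<mu> U (\<lambda>u. (f u + x \<bullet> g u - C) / \<epsilon>)"
      using int by auto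
    show "set_integrable \<mu> U (\<lambda>u. (f u + g u \<bullet> x - cost u y) / \<epsilon>)"
      using 1 by (rule integrable_U)
    show "(f u + x \<bullet> g u - C) / \<epsilon> \<le> (f u + g u \<bullet> x - cost u y) / \<epsilon>" if "u \<in> U" for u
      using cost_le[OF that, of y] assms eps_pos
      by (intro divide_right_mono) (auto simp: inner_commute)
  qed
  finally have "exp (- C / \<epsilon>) \<le> exp (LINT u:U|\<mu>. (f u + g u \<bullet> x - cost u y) / \<epsilon>)"
    by simp
  also have "\<dots> \<le> I"
    unfolding I_def by (rule jensen_U[OF 1])
  finally have "exp (- C / \<epsilon>) \<le> I" .
  then have "- C / \<epsilon> \<le> ln I"
    by (metis exp_gt_zero less_le_trans ln_ge_iff)
  then have "- C \<le> ln I * \<epsilon>"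
    using eps_pos by (simp only: pos_divide_le_eq)
  then show ?thesis
    using h_eq[OF assms] by (simp add: I_def algebra_simps)
qed

section \<open>Sign of the integral of \<open>h\<close>\<close>

text \<open>By Tonelli it suffices to integrate over \<open>z\<close> first, and the equation of
  \<open>f\<close> normalises that inner integral for each \<open>u\<close>. Hence the penalty term
  of the dual objective vanishes at the potentials.\<close>

lemma total_mass:
  "(\<integral>\<^sup>+ (u, z) \<in> U \<times> Z. ennreal (expo \<epsilon> f g h u z) \<partial>(\<mu> \<Otimes>\<^sub>M \<nu>)) = 1"
proof -
  interpret \<mu>: prob_space \<mu> by (rule prob_\<mu>)
  interpret \<nu>: prob_space \<nu> by (rule prob_\<nu>)
  define F where "F = (\<lambda>p. expo \<epsilon> f g h (fst p) (snd p))"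
  \<comment> \<open>The product sigma-algebra is the Borel one, so continuity on the compact product
    yields joint measurability.\<close>
  have sets_prod: "sets (\<mu> \<Otimes>\<^sub>M \<nu>) = sets borel"
    using sets_pair_measure_cong[OF sets_\<mu> sets_\<nu>] by (metis borel_prod)
  have "continuous_on (U \<times> Z) F"
    unfolding F_def expo_def using eps_pos
    by (intro continuous_intros continuous_on_compose2[OF cont_f] continuous_on_compose2[OF cont_g]
        continuous_on_compose2[OF cont_h]) auto
  then have "(\<lambda>p. indicator (U \<times> Z) p *\<^sub>R F p) \<in> borel_measurable borel"
    by (intro borel_measurable_continuous_on_indicator borel_compact compact_Times compact_U compact_Z)
  then have meas: "(\<lambda>p. ennreal (indicator (U \<times> Z) p *\<^sub>R F p)) \<in> borel_measurable (\<mu> \<Otimes>\<^sub>M \<nu>)"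
    unfolding measurable_cong_sets[OF sets_prod refl] by measurable
  have "(\<integral>\<^sup>+ (u, z) \<in> U \<times> Z. ennreal (expo \<epsilon> f g h u z) \<partial>(\<mu> \<Otimes>\<^sub>M \<nu>))
      = (\<integral>\<^sup>+ p. ennreal (indicator (U \<times> Z) p *\<^sub>R F p) \<partial>(\<mu> \<Otimes>\<^sub>M \<nu>))"
    by (intro nn_integral_cong) (auto simp: F_def split: split_indicator)
  also have "\<dots> = (\<integral>\<^sup>+ u. \<integral>\<^sup>+ z. ennreal (indicator (U \<times> Z) (u, z) *\<^sub>R F (u, z)) \<partial>\<nu> \<partial>\<mu>)"
    by (rule \<nu>.nn_integral_fst[OF meas, symmetric])
  also have "\<dots> = (\<integral>\<^sup>+ u. 1 \<partial>\<mu>)"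
  proof (rule nn_integral_cong_AE, use AE_U in eventually_elim)
    fix u assume u: "u \<in> U"
    have eq: "indicator (U \<times> Z) (u, z) *\<^sub>R F (u, z) = indicator Z z *\<^sub>R (exp (f u / \<epsilon>) * kernel (g u) u z)" for z
      using u by (auto simp: F_def expo_def kernel_def diff_divide_distrib add_divide_distrib
          simp flip: exp_add split: split_indicator)
    have "set_integrable \<nu> Z (\<lambda>z. exp (f u / \<epsilon>) * kernel (g u) u z)"
      by (intro integrable_Z continuous_intros)
    then have "(\<integral>\<^sup>+ z. ennreal (indicator Z z *\<^sub>R (exp (f u / \<epsilon>) * kernel (g u) u z)) \<partial>\<nu>)
        = ennreal (LINT z:Z|\<nu>. exp (f u / \<epsilon>) * kernel (g u) u z)"
      unfolding set_lebesgue_integral_def set_integrable_def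
      by (rule nn_integral_eq_integral) (simp add: kernel_def)
    also have "(LINT z:Z|\<nu>. exp (f u / \<epsilon>) * kernel (g u) u z) = 1"
      using integral_kernel[OF u] by (simp flip: exp_add)
    finally show "(\<integral>\<^sup>+ z. ennreal (indicator (U \<times> Z) (u, z) *\<^sub>R F (u, z)) \<partial>\<nu>) = 1"
      by (simp only: eq ennreal_1)
  qed
  also have "\<dots> = 1"
    by (simp add: \<mu>.emeasure_space_1)
  finally show ?thesis .
qed

text \<open>At the potentials the objective equals the integral of \<open>h\<close>, since
  \<open>f\<close> has mean zero and the total mass is one. At the zero triple it is nonnegative,
  since the cost is nonnegative. Maximality compares the two.\<close>

lemma integral_h_nonneg: "0 \<le> (LINT z:Z|\<nu>. h z)"
proof -
  interpret \<mu>: prob_space \<mu> by (rule prob_\<mu>)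
  interpret \<nu>: prob_space \<nu> by (rule prob_\<nu>)
  interpret P: pair_prob_space \<mu> \<nu> ..
  define J where "J = (\<integral>\<^sup>+ (u, z) \<in> U \<times> Z. ennreal (expo \<epsilon> (\<lambda>_. 0) (\<lambda>_. 0) (\<lambda>_. 0) u z) \<partial>(\<mu> \<Otimes>\<^sub>M \<nu>))"
  have "J \<le> (\<integral>\<^sup>+ p. 1 \<partial>(\<mu> \<Otimes>\<^sub>M \<nu>))"
    unfolding J_def using eps_pos
    by (intro nn_integral_mono)
      (auto simp: expo_def cost_nonneg split: split_indicator intro: divide_nonneg_pos)
  also have "\<dots> = 1"
    by (simp add: P.emeasure_space_1)
  finally have J: "J \<le> 1" .
  \<comment> \<open>Excluding an infinite mass turns the extended-real objective at zero into a real
    number.\<close>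
  then obtain j where j: "J = ennreal j" "0 \<le> j" "j \<le> 1"
    by (cases J) (auto simp: ennreal_le_1 top_unique)
  have "L1_triple \<mu> \<nu> (\<lambda>_. 0) (\<lambda>_. 0 :: real^'m) (\<lambda>_. 0)"
    by (simp add: L1_triple_def set_integrable_def)
  then have "dual_objective \<mu> \<nu> \<epsilon> (\<lambda>_. 0) (\<lambda>_. 0) (\<lambda>_. 0) \<le> dual_objective \<mu> \<nu> \<epsilon> f g h"
    using maximal unfolding maximizes_dual_def by blast
  moreover have "dual_objective \<mu> \<nu> \<epsilon> f g h = ereal (LINT z:Z|\<nu>. h z)"
    by (simp add: dual_objective_def total_mass mean_f one_ennreal.rep_eq one_ereal_def)
  moreover have "dual_objective \<mu> \<nu> \<epsilon> (\<lambda>_. 0) (\<lambda>_. 0) (\<lambda>_. 0) = ereal (- \<epsilon> * (j - 1))"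
    unfolding dual_objective_def J_def[symmetric]
    using j by (simp add: set_lebesgue_integral_def one_ereal_def)
  moreover have "0 \<le> - \<epsilon> * (j - 1)"
    using j eps_pos by (simp add: mult_le_0_iff)
  ultimately show ?thesis
    by simp
qed

section \<open>Two-sided bound on \<open>f\<close>\<close>

text \<open>In the mean of the exponent, \<open>g u\<close> drops out because \<open>X\<close> is
  centred, and \<open>h\<close> contributes a nonnegative amount; Jensen's inequality does the
  rest.\<close>

lemma f_upper:
  assumes u: "u \<in> U"
  shows "f u \<le> C"
proof -
  have int: "set_integrable \<nu> Z (\<lambda>z. g u \<bullet> fst z)" "set_integrable \<nu> Z h" "set_integrable \<nu> Z (\<lambda>z. C)"
    "set_integrable \<nu> Z fst"
    by (intro integrable_Z continuous_intros cont_h)+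
  have 1: "continuous_on Z (\<lambda>z. (g u \<bullet> fst z + h z - cost u (snd z)) / \<epsilon>)"
    using eps_pos by (intro continuous_intros cont_h) auto
  have "- C / \<epsilon> \<le> (g u \<bullet> (LINT z:Z|\<nu>. fst z) + (LINT z:Z|\<nu>. h z) - C) / \<epsilon>"
    using integral_h_nonneg eps_pos by (intro divide_right_mono) (auto simp: mean_X_Z)
  also have "\<dots> = (LINT z:Z|\<nu>. (g u \<bullet> fst z + h z - C) / \<epsilon>)"
    using int by (simp add: set_integral_inner_right const_Z)
  also have "\<dots> \<le> (LINT z:Z|\<nu>. (g u \<bullet> fst z + h z - cost u (snd z)) / \<epsilon>)"
  proof (rule set_integral_mono)
    show "set_integrable \<nu> Z (\<lambda>z. (g u \<bullet> fst z + h z - C) / \<epsilon>)"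
      using int by auto
    show "set_integrable \<nu> Z (\<lambda>z. (g u \<bullet> fst z + h z - cost u (snd z)) / \<epsilon>)"
      using 1 by (rule integrable_Z)
    show "(g u \<bullet> fst z + h z - C) / \<epsilon> \<le> (g u \<bullet> fst z + h z - cost u (snd z)) / \<epsilon>" if "z \<in> Z" for z
      using cost_le[OF u, of "snd z"] that eps_pos by (intro divide_right_mono) auto
  qed
  finally have "exp (- C / \<epsilon>) \<le> exp (LINT z:Z|\<nu>. (g u \<bullet> fst z + h z - cost u (snd z)) / \<epsilon>)"
    by simp
  also have "\<dots> \<le> exp (- f u / \<epsilon>)"
    using jensen_Z[OF 1] integral_kernel[OF u] by (simp add: kernel_def)
  finally show ?thesis
    using eps_pos by (simp add: divide_le_cancel)
qed

lemma f_lower: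
  assumes u: "u \<in> U"
  shows "- C \<le> f u"
proof -
  have int: "set_integrable \<nu> Z (kernel (g u) u)" "set_integrable \<nu> Z (\<lambda>z. kernel (g u) u z *\<^sub>R fst z)"
    by (intro integrable_Z continuous_intros)+
  have "set_integrable \<nu> Z (\<lambda>z. (1 / \<epsilon>) * (g u \<bullet> (kernel (g u) u z *\<^sub>R fst z)))"
    by (intro integrable_Z continuous_intros)
  note int = int this
  \<comment> \<open>The subtracted term vanishes by the constraint. It comes from the derivative at
    \<open>g u\<close>, in the direction \<open>- g u\<close>, of the integral of
    \<open>kernel \<theta> u\<close> as a function of \<open>\<theta>\<close>.\<close>
  have "exp (- f u / \<epsilon>) = (LINT z:Z|\<nu>. kernel (g u) u z) - (1 / \<epsilon>) * (g u \<bullet> (LINT z:Z|\<nu>. kernel (g u) u z *\<^sub>R fst z))"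
    by (simp add: integral_kernel[OF u] constraint[OF u])
  also have "\<dots> = (LINT z:Z|\<nu>. kernel (g u) u z - (1 / \<epsilon>) * (g u \<bullet> (kernel (g u) u z *\<^sub>R fst z)))"
    unfolding set_integral_diff(2)[OF int(1,3)] set_integral_mult_right set_integral_inner_right[OF int(2)] ..
  also have "\<dots> \<le> (LINT z:Z|\<nu>. exp (C / \<epsilon>))"
  proof (rule set_integral_mono)
    show "set_integrable \<nu> Z (\<lambda>z. kernel (g u) u z - (1 / \<epsilon>) * (g u \<bullet> (kernel (g u) u z *\<^sub>R fst z)))"
      using int by (intro set_integral_diff)
    show "set_integrable \<nu> Z (\<lambda>z. exp (C / \<epsilon>))"
      by (intro integrable_Z continuous_intros)
    fix z assume z: "z \<in> Z"
    \<comment> \<open>Convexity in \<open>\<theta>\<close>: the tangent at \<open>g u\<close>,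
      evaluated at zero, lies below the value at zero.\<close>
    have "kernel (g u) u z * (1 + - (g u \<bullet> fst z / \<epsilon>)) \<le> kernel (g u) u z * exp (- (g u \<bullet> fst z / \<epsilon>))"
      by (intro mult_left_mono exp_ge_add_one_self) (simp add: kernel_def)
    also have "\<dots> = exp ((h z - cost u (snd z)) / \<epsilon>)"
      by (simp add: kernel_def add_divide_distrib diff_divide_distrib flip: exp_add)
    also have "\<dots> \<le> exp (C / \<epsilon>)"
      using h_upper[of "fst z" "snd z"] z cost_nonneg[of u "snd z"] eps_pos
      by (auto intro!: divide_right_mono)
    finally show "kernel (g u) u z - (1 / \<epsilon>) * (g u \<bullet> (kernel (g u) u z *\<^sub>R fst z)) \<le> exp (C / \<epsilon>)"
      by (simp add: algebra_simps)
  qed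
  finally have "- f u / \<epsilon> \<le> C / \<epsilon>"
    by (simp add: const_Z)
  then have "- f u \<le> C"
    using eps_pos by (simp only: divide_le_cancel)
  then show ?thesis
    by simp
qed

section \<open>Lower bound on \<open>h\<close>\<close>

lemma norm_g_le: "u \<in> U \<Longrightarrow> norm (g u) \<le> sup_norm U g"
  using norm_le_sup_norm[OF compact_U cont_g] .

text \<open>The sup norm of the identity is the radius about the origin of the support of
  \<open>X\<close>.\<close>

lemma norm_x_le: "x \<in> supp_X \<nu> \<Longrightarrow> norm x \<le> sup_norm (supp_X \<nu>) (\<lambda>x. x)"
  using norm_le_sup_norm[OF compact_X continuous_on_id] .

lemma radius_nonneg: "0 \<le> sup_norm (supp_X \<nu>) (\<lambda>x. x)"
  using Z_nonempty norm_x_le norm_ge_zero order_trans by blast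

text \<open>The exponent in the equation of \<open>h\<close> is bounded pointwise, by
  \<open>f_upper\<close>, a nonnegative cost and the Cauchy-Schwarz inequality.\<close>

lemma h_lower:
  assumes "(x, y) \<in> Z"
  shows "- (C + sup_norm U g * sup_norm (supp_X \<nu>) (\<lambda>x. x)) \<le> h (x, y)" (is "- ?B \<le> _")
proof -
  define I where "I = (LINT u:U|\<mu>. exp ((f u + g u \<bullet> x - cost u y) / \<epsilon>))"
  have 1: "continuous_on U (\<lambda>u. (f u + g u \<bullet> x - cost u y) / \<epsilon>)"
    using eps_pos by (intro continuous_intros cont_f cont_g) auto
  have "I \<le> (LINT u:U|\<mu>. exp (?B / \<epsilon>))"
    unfolding I_def
  proof (rule set_integral_mono)
    show "set_integrable \<mu> U (\<lambda>u. exp ((f u + g u \<bullet> x - cost u y) / \<epsilon>))"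
      using 1 by (intro integrable_U continuous_on_exp)
    show "set_integrable \<mu> U (\<lambda>u. exp (?B / \<epsilon>))"
      by (intro integrable_U continuous_intros)
    fix u assume u: "u \<in> U"
    have "g u \<bullet> x \<le> norm (g u) * norm x"
      by (rule norm_cauchy_schwarz)
    also have "\<dots> \<le> sup_norm U g * sup_norm (supp_X \<nu>) (\<lambda>x. x)"
      using norm_g_le[OF u] norm_x_le[of x] assms order_trans[OF norm_ge_zero norm_g_le[OF u]]
      by (intro mult_mono) auto
    finally show "exp ((f u + g u \<bullet> x - cost u y) / \<epsilon>) \<le> exp (?B / \<epsilon>)"
      using f_upper[OF u] cost_nonneg[of u y] eps_pos by (auto intro!: divide_right_mono)
  qed
  moreover have "0 < I"
    unfolding I_def by (rule less_le_trans[OF exp_gt_zero jensen_U[OF 1]])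
  ultimately have "ln I \<le> ln (exp (?B / \<epsilon>))"
    by (subst ln_le_cancel_iff) (simp_all add: const_U)
  then have "\<epsilon> * ln I \<le> ?B"
    using eps_pos by (simp add: pos_le_divide_eq mult.commute)
  then show ?thesis
    using h_eq[OF assms] by (simp add: I_def)
qed

section \<open>Bound on \<open>g\<close> by tilting the law\<close>

text \<open>Since \<open>X\<close> is centred, this is the mean of
  \<open>\<theta> \<bullet> fst z\<close> under the density \<open>1 + a \<bullet> fst z\<close>.
  The proof expands both inner products in coordinates.\<close>

lemma second_moment_quadratic:
  "(LINT z:Z|\<nu>. (a \<bullet> fst z) * (\<theta> \<bullet> fst z)) = \<theta> \<bullet> (second_moment_X \<nu> *v a)"
proof -
  have meas: "(\<lambda>z. fst z $ i * fst z $ j) \<in> borel_measurable \<nu>" for i j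
    unfolding measurable_cong_sets[OF sets_\<nu> refl]
    by (intro borel_measurable_continuous_onI continuous_intros)
  have entry: "second_moment_X \<nu> $ i $ j = (LINT z:Z|\<nu>. fst z $ i * fst z $ j)" for i j
    using set_lebesgue_integral_eq_AE[OF AE_Z Z_sets meas] by (simp add: second_moment_X_def)
  have int: "integrable \<nu> (\<lambda>z. \<theta> $ i * (a $ j * (indicator Z z * (fst z $ i * fst z $ j))))" for i j
  proof -
    have "set_integrable \<nu> Z (\<lambda>z. fst z $ i * fst z $ j)"
      by (intro integrable_Z continuous_intros)
    then show ?thesis
      by (simp add: set_integrable_def)
  qed
  have pointwise: "(a \<bullet> x) * (\<theta> \<bullet> x) = (\<Sum>i\<in>UNIV. \<Sum>j\<in>UNIV. \<theta> $ i * (a $ j * (x $ i * x $ j)))" for x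
    by (subst mult.commute) (simp add: inner_vec_def sum_product mult_ac)
  have "(LINT z:Z|\<nu>. (a \<bullet> fst z) * (\<theta> \<bullet> fst z))
      = (LINT z|\<nu>. (\<Sum>i\<in>UNIV. \<Sum>j\<in>UNIV. \<theta> $ i * (a $ j * (indicator Z z * (fst z $ i * fst z $ j)))))"
    unfolding set_lebesgue_integral_def pointwise
    by (simp add: sum_distrib_left mult_ac)
  also have "\<dots> = (\<Sum>i\<in>UNIV. \<Sum>j\<in>UNIV. \<theta> $ i * (a $ j * (LINT z:Z|\<nu>. fst z $ i * fst z $ j)))"
    using int by (simp add: set_lebesgue_integral_def)
  also have "\<dots> = \<theta> \<bullet> (second_moment_X \<nu> *v a)"
    by (simp add: inner_vec_def matrix_vector_mult_def entry sum_distrib_left mult_ac)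
  finally show ?thesis .
qed

text \<open>Jensen's inequality with weight \<open>1 + a \<bullet> fst z\<close>. Of the factor
  \<open>5 / 2\<close>, the share \<open>3 / 2\<close> comes from the weighted \<open>h\<close> and
  cost, and the share \<open>1\<close> from \<open>f_lower\<close>; the logarithm comes from the
  upper bound on the weight.\<close>

lemma tilted_bound:
  assumes u: "u \<in> U" and a: "\<And>x. x \<in> supp_X \<nu> \<Longrightarrow> \<bar>a \<bullet> x\<bar> \<le> 1 / 2"
  shows "g u \<bullet> (second_moment_X \<nu> *v a) \<le> 5 / 2 * C + \<epsilon> * ln (3 / 2)"
proof -
  define \<theta> where "\<theta> = g u"
  define w where "w z = 1 + a \<bullet> fst z" for z :: "(real^'m) \<times> (real^'n)"
  define \<psi> where "\<psi> z = (\<theta> \<bullet> fst z + h z - cost u (snd z)) / \<epsilon>" for z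
  have w: "1 / 2 \<le> w z" "w z \<le> 3 / 2" if "z \<in> Z" for z
    using a[of "fst z"] that by (auto simp: w_def abs_le_iff)
  have cont: "continuous_on Z w" "continuous_on Z \<psi>"
    unfolding w_def \<psi>_def using eps_pos by (intro continuous_intros cont_h; simp)+
  have int: "set_integrable \<nu> Z fst" "set_integrable \<nu> Z h" "set_integrable \<nu> Z (\<lambda>z. (1::real))"
    "set_integrable \<nu> Z (\<lambda>z. a \<bullet> fst z)" "set_integrable \<nu> Z (\<lambda>z. \<theta> \<bullet> fst z)"
    "set_integrable \<nu> Z (\<lambda>z. (a \<bullet> fst z) * (\<theta> \<bullet> fst z))"
    "set_integrable \<nu> Z (\<lambda>z. 3 / 2 * C)"
    by (intro integrable_Z continuous_intros cont_h)+
  have w1: "(LINT z:Z|\<nu>. w z) = 1"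
    using int by (simp add: w_def set_integral_inner_right mean_X_Z const_Z)
  \<comment> \<open>The inserted terms are zero and nonnegative respectively; with them the right
    side becomes a single integral.\<close>
  have "(\<theta> \<bullet> (second_moment_X \<nu> *v a) - 3 / 2 * C) / \<epsilon>
      \<le> (\<theta> \<bullet> (LINT z:Z|\<nu>. fst z) + \<theta> \<bullet> (second_moment_X \<nu> *v a)
          + 3 / 2 * (LINT z:Z|\<nu>. h z) - 3 / 2 * C) / \<epsilon>"
    using integral_h_nonneg eps_pos by (intro divide_right_mono) (auto simp: mean_X_Z)
  also have "\<dots> = (LINT z:Z|\<nu>. (\<theta> \<bullet> fst z + (a \<bullet> fst z) * (\<theta> \<bullet> fst z) + 3 / 2 * h z - 3 / 2 * C) / \<epsilon>)"
    using int by (simp add: second_moment_quadratic set_integral_inner_right const_Z)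
  also have "\<dots> \<le> (LINT z:Z|\<nu>. w z * \<psi> z)"
  proof (rule set_integral_mono)
    show "set_integrable \<nu> Z (\<lambda>z. (\<theta> \<bullet> fst z + (a \<bullet> fst z) * (\<theta> \<bullet> fst z) + 3 / 2 * h z - 3 / 2 * C) / \<epsilon>)"
      using int by (intro set_integrable_divide set_integral_add set_integral_diff) auto
    show "set_integrable \<nu> Z (\<lambda>z. w z * \<psi> z)"
      using cont by (intro integrable_Z continuous_intros)
    fix z assume z: "z \<in> Z"
    \<comment> \<open>Only the unweighted integral of \<open>h\<close> has a known sign. As
      \<open>h z - C\<close> is nonpositive, its weight may be raised to the constant
      \<open>3 / 2\<close>.\<close>
    have "0 \<le> (3 / 2 - w z) * (C - h z)"
      using h_upper[of "fst z" "snd z"] w[OF z] z by auto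
    moreover have "w z * cost u (snd z) \<le> w z * C"
      using w[OF z] z cost_le[OF u, of "snd z"] by (intro mult_left_mono) auto
    ultimately have "w z * (\<theta> \<bullet> fst z) + 3 / 2 * h z - 3 / 2 * C
        \<le> w z * (\<theta> \<bullet> fst z + h z - cost u (snd z))"
      by (simp add: algebra_simps diff_divide_distrib)
    then show "(\<theta> \<bullet> fst z + (a \<bullet> fst z) * (\<theta> \<bullet> fst z) + 3 / 2 * h z - 3 / 2 * C) / \<epsilon> \<le> w z * \<psi> z"
      using eps_pos by (simp add: \<psi>_def divide_le_cancel) (simp add: w_def algebra_simps)
  qed
  finally have "exp ((\<theta> \<bullet> (second_moment_X \<nu> *v a) - 3 / 2 * C) / \<epsilon>) \<le> exp (LINT z:Z|\<nu>. w z * \<psi> z)"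
    by simp
  also have "\<dots> \<le> (LINT z:Z|\<nu>. w z * exp (\<psi> z))"
  proof (rule exp_weighted_integral_le)
    show "0 \<le> w z" if "z \<in> Z" for z
      using w(1)[OF that] by simp
  qed (use cont w1 in \<open>auto intro!: integrable_Z continuous_intros\<close>)
  also have "\<dots> \<le> (LINT z:Z|\<nu>. 3 / 2 * exp (\<psi> z))"
    using cont w(2) by (intro set_integral_mono integrable_Z continuous_intros mult_right_mono) auto
  also have "\<dots> = 3 / 2 * exp (- f u / \<epsilon>)"
    using integral_kernel[OF u] by (simp add: kernel_def \<psi>_def \<theta>_def)
  also have "\<dots> \<le> 3 / 2 * exp (C / \<epsilon>)"
    using f_lower[OF u] eps_pos divide_right_mono[of "- f u" C \<epsilon>] by simp
  also have "\<dots> = exp (ln (3 / 2) + C / \<epsilon>)"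
    by (simp add: exp_add)
  finally have "(\<theta> \<bullet> (second_moment_X \<nu> *v a) - 3 / 2 * C) / \<epsilon> \<le> ln (3 / 2) + C / \<epsilon>"
    by simp
  then have "\<theta> \<bullet> (second_moment_X \<nu> *v a) - 3 / 2 * C \<le> (ln (3 / 2) + C / \<epsilon>) * \<epsilon>"
    using eps_pos by (simp only: pos_divide_le_eq)
  also have "\<dots> = \<epsilon> * ln (3 / 2) + C"
    using eps_pos by (simp add: algebra_simps)
  finally show ?thesis
    by (simp add: \<theta>_def)
qed

text \<open>A vector \<open>a\<close> whose image under the second moment matrix is a multiple of
  \<open>g u\<close> turns \<open>tilted_bound\<close> into a bound on the norm; the multiple is
  taken as large as the condition on \<open>a\<close> allows.\<close>

lemma g_bound:
  assumes u: "u \<in> U"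
  shows "norm (g u) \<le> 2 * op_norm (matrix_inv (second_moment_X \<nu>)) * sup_norm (supp_X \<nu>) (\<lambda>x. x)
    * (5 / 2 * C + \<epsilon> * ln (3 / 2))"
proof -
  define A where "A = matrix_inv (second_moment_X \<nu>)"
  define K where "K = op_norm A * sup_norm (supp_X \<nu>) (\<lambda>x. x)"
  define B where "B = 5 / 2 * C + \<epsilon> * ln (3 / 2)"
  have lin: "bounded_linear ((*v) A)"
    by (simp add: matrix_vector_mul_bounded_linear)
  have op: "0 \<le> op_norm A" "norm (A *v x) \<le> op_norm A * norm x" for x
    unfolding op_norm_def using onorm_pos_le[OF lin] onorm[OF lin] by auto
  have K: "0 \<le> K"
    using op radius_nonneg by (simp add: K_def)
  \<comment> \<open>The length \<open>s\<close> stays free, so that the degenerate case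
    \<open>K = 0\<close> is covered too.\<close>
  have scaled: "s * norm (g u) \<le> B" if s: "0 \<le> s" "s * K \<le> 1 / 2" for s
  proof -
    \<comment> \<open>The second moment matrix sends \<open>a\<close> to
      \<open>s *\<^sub>R sgn (g u)\<close>, whose inner product with \<open>g u\<close> is
      \<open>s * norm (g u)\<close>.\<close>
    define a where "a = A *v (s *\<^sub>R sgn (g u))"
    have "norm (sgn (g u)) \<le> 1"
      by (simp add: norm_sgn)
    then have "norm a \<le> op_norm A * s"
      using order_trans[OF op(2) mult_left_mono[OF _ op(1)]] s(1)
      by (simp add: a_def mult_left_le)
    then have "norm a * norm x \<le> s * K" if "x \<in> supp_X \<nu>" for x
      using mult_mono[OF _ norm_x_le[OF that], of "norm a" "op_norm A * s"] op(1) s(1)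
      by (simp add: K_def mult_ac)
    then have "\<bar>a \<bullet> x\<bar> \<le> 1 / 2" if "x \<in> supp_X \<nu>" for x
      using Cauchy_Schwarz_ineq2[of a x] that s(2) by fastforce
    then have "g u \<bullet> (second_moment_X \<nu> *v a) \<le> B"
      unfolding B_def by (rule tilted_bound[OF u])
    moreover have "second_moment_X \<nu> *v a = s *\<^sub>R sgn (g u)"
      using matrix_inv_right[OF inv_second_moment]
      by (simp add: a_def A_def matrix_vector_mul_assoc)
    moreover have "g u \<bullet> sgn (g u) = norm (g u)"
      by (cases "g u = 0") (simp_all add: sgn_div_norm dot_square_norm power2_eq_square)
    ultimately show ?thesis
      by simp
  qed
  have "norm (g u) \<le> 2 * K * B"
  proof (cases "K = 0")
    case True
    have "norm (g u) = 0"
    proof (rule ccontr)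
      assume *: "norm (g u) \<noteq> 0"
      then show False
        \<comment> \<open>With \<open>K = 0\<close> every \<open>s \<ge> 0\<close> is admissible;
          this one makes \<open>s * norm (g u)\<close> exceed \<open>B\<close>.\<close>
        using scaled[of "(\<bar>B\<bar> + 1) / norm (g u)"] True by simp
    qed
    then show ?thesis
      using True by simp
  next
    case False
    then show ?thesis
      \<comment> \<open>The largest admissible \<open>s\<close>; it produces the factor
        \<open>2\<close>.\<close>
      using scaled[of "1 / (2 * K)"] K by (simp add: field_simps)
  qed
  then show ?thesis
    by (simp add: K_def A_def B_def mult_ac)
qed

end

section \<open>From pointwise bounds to sup norms\<close>

theorem proposition2p1:
  fixes \<mu> :: "(real^'n) measure"
    and \<nu> :: "((real^'m) \<times> (real^'n)) measure"
    and \<epsilon> :: real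
    and f :: "real^'n \<Rightarrow> real"
    and g :: "real^'n \<Rightarrow> real^'m"
    and h :: "(real^'m) \<times> (real^'n) \<Rightarrow> real"
  assumes "prob_space \<mu>" and "sets \<mu> = sets borel"
    and "prob_space \<nu>" and "sets \<nu> = sets borel"
    and "compact (measure_support \<mu>)" and "compact (supp_X \<nu>)" and "compact (supp_Y \<nu>)"
    and "(LINT z|\<nu>. fst z) = 0"
    and "invertible (second_moment_X \<nu>)"
    and "\<epsilon> > 0"
    and "dual_potentials \<mu> \<nu> \<epsilon> f g h"
  shows "sup_norm (measure_support \<mu>) f \<le> cost_sup \<mu> \<nu> \<and>
    sup_norm (measure_support \<mu>) g
      \<le> 2 * op_norm (matrix_inv (second_moment_X \<nu>)) * sup_norm (supp_X \<nu>) (\<lambda>x. x)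
          * (5 / 2 * cost_sup \<mu> \<nu> + \<epsilon> * ln (3 / 2)) \<and>
    sup_norm (supp_X \<nu> \<times> supp_Y \<nu>) h
      \<le> cost_sup \<mu> \<nu> + sup_norm (measure_support \<mu>) g * sup_norm (supp_X \<nu>) (\<lambda>x. x)"
proof -
  interpret entropic_dual \<mu> \<nu> \<epsilon> f g h
    using assms by (rule entropic_dual.intro)
  \<comment> \<open>Nonnegativity lets the sharper upper bound \<open>C\<close> on \<open>h\<close>
    fit under the same constant as the lower bound.\<close>
  have "0 \<le> sup_norm U g * sup_norm (supp_X \<nu>) (\<lambda>x. x)"
    using U_nonempty norm_g_le norm_ge_zero order_trans radius_nonneg
    by (metis all_not_in_conv mult_nonneg_nonneg)
  then have "norm (h z) \<le> C + sup_norm U g * sup_norm (supp_X \<nu>) (\<lambda>x. x)" if "z \<in> Z" for z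
    using h_upper[of "fst z" "snd z"] h_lower[of "fst z" "snd z"] that by (simp add: abs_le_iff)
  moreover have "norm (f u) \<le> C" if "u \<in> U" for u
    using f_upper[OF that] f_lower[OF that] by (simp add: abs_le_iff)
  ultimately show ?thesis
    using g_bound by (intro conjI sup_norm_le U_nonempty Z_nonempty) auto
qed

end
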